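(* Let $A$ be a finite totally ordered set. The kernel of $\varphi:\mathbb{Z}Q(A)\to\mathbb{Z}\mathrm{Styl}(A)$ is spanned by the elements which are differences of two paths in $Q(A)$ starting from the same vertex $\gamma$ and having labels $u,v$ satisfying $\gamma u\equiv_{styl}\gamma v$ (where $\gamma$ is viewed as a decreasing word).
   Context: $A$ is a finite totally ordered set, whose elements are called letters, and $A^*$ is the free monoid on $A$. A column on $A$ is a subset of $A$ (also viewed as the word in $A^*$ that is the strictly decreasing product of its elements); $\Gamma(A)$ is the set of columns. Left action of $A^*$ on $\Gamma(A)$: for a letter $a$ and a column $\gamma$, if $a>y$ for all $y\in\gamma$, then $a\cdot\gamma=\gamma\cup\{a\}$; otherwise $a\cdot\gamma=(\gamma\setminus\{y\})\cup\{a\}$, where $y$ is the smallest element of $\gamma$ with $y\ge a$. This extends to words by $(uv)\cdot\gamma=u\cdot(v\cdot\gamma)$. The stylic monoid $\mathrm{Styl}(A)$ is the monoid (under composition) of the functions $\mu_w:\Gamma(A)\to\Gamma(A)$, $\gamma\mapsto w\cdot\gamma$, for $w\in A^*$; $\mathbb{Z}\mathrm{Styl}(A)$ is its monoid algebra over $\mathbb{Z}$. For $u,v\in A^*$, $u\equiv_{styl}v$ means $\mu_u=\mu_v$. A letter or word is identified with its image $\mu_w$ when computing in the algebra. For $\gamma\in\Gamma(A)$, $$e_\gamma=\prod^{\nearrow}_{a\in A\setminus\gamma}(1-a)\ \prod^{\searrow}_{a\in\gamma}a\ \in\mathbb{Z}\mathrm{Styl}(A),$$ where the first product is taken in increasing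 order of letters and the second in decreasing order. Right action of $A^*$ on $\Gamma(A)$: for a column $\gamma$ and a letter $c$, if $c<x$ for all $x\in\gamma$ (in particular if $\gamma=\emptyset$), then $\gamma\cdot c=\gamma\cup\{c\}$; otherwise $\gamma\cdot c=(\gamma\setminus\{b\})\cup\{c\}$ with $b=\max\{x\in\gamma:x\le c\}$. The right action of $c$ on $\gamma$ is called frank if $\gamma\ne\emptyset$, $c\ge\min(\gamma)$ and $c\notin\gamma$. The quiver $Q(A)$ has vertex set $\Gamma(A)$, and has a labelled edge $\gamma\xrightarrow{c}\gamma'$ whenever $\gamma\cdot c=\gamma'$ and this action is frank. The label of a path is the word in $A^*$ that is the product of the labels of its edges. The path algebra $\mathbb{Z}Q(A)$ is the free $\mathbb{Z}$-module on the paths of $Q(A)$ (including an empty path at each vertex $\gamma$, denoted $\gamma$), with product given by concatenation of paths, read from left to right, and $0$ for non-composable paths. The map $\varphi:\mathbb{Z}Q(A)\to\mathbb{Z}\mathrm{Styl}(A)$ is the $\mathbb{Z}$-algebra homomorphism sending the empty path $\gamma$ to $e_\gamma$ and a path $\gamma_0\xrightarrow{c_1}\gamma_1\xrightarrow{c_2}\cdots\xrightarrow{c_l}\gamma_l$ to $e_{\gamma_0}c_1e_{\gamma_1}c_2\cdots c_le_{\gamma_l}$. *)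

theory Defs
  imports
    "HOL-Library.Poly_Mapping"
    "HOL-Library.FuncSet"
    "HOL-Algebra.AbelCoset"
    "Graph_Theory.Arc_Walk"
begin

text \<open>
  The totally ordered set \<open>A\<close> is a subset of a type of class \<open>linorder\<close>, carrying the induced
  order; its finiteness is an explicit hypothesis, and \<open>A\<close> may be empty. Words are lists and
  \<open>A\<^sup>*\<close> is \<open>lists A\<close>.
\<close>


section \<open>Algebras with underlying module a free \<open>\<int>\<close>-module\<close>

text \<open>
  \<open>'b \<Rightarrow>\<^sub>0 int\<close> is the free \<open>\<int>\<close>-module on \<open>'b\<close>, with basis \<open>frag_of\<close>, scalar multiplication
  \<open>frag_cmul\<close>, and linear extension of maps on the basis given by \<open>frag_extend\<close>.
  The interpretation makes \<open>frag.span\<close> the \<open>\<int>\<close>-linear span.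
\<close>

global_interpretation frag: Modules.module frag_cmul
  by standard (simp_all add: frag_cmul_distrib frag_cmul_distrib2)

definition monoid_algebra :: "('m, 'x) monoid_scheme \<Rightarrow> ('m \<Rightarrow>\<^sub>0 int) ring"
  where "monoid_algebra M =
    \<lparr> carrier = {f. Poly_Mapping.keys f \<subseteq> carrier M},
      monoid.mult = (\<lambda>f g. frag_extend (\<lambda>x. frag_extend (\<lambda>y. frag_of (x \<otimes>\<^bsub>M\<^esub> y)) g) f),
      one = frag_of \<one>\<^bsub>M\<^esub>,
      zero = 0,
      add = (+) \<rparr>"

text \<open>
  A path is a pair of its initial vertex and the list of its arcs, so that there is one empty path
  at each vertex.
\<close>

definition paths :: "('v, 'e) pre_digraph \<Rightarrow> ('v \<times> 'e list) set"
  where "paths G = {(u, p). \<exists>v. pre_digraph.awalk G u p v}"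

definition path_mult ::
    "('v, 'e) pre_digraph \<Rightarrow> 'v \<times> 'e list \<Rightarrow> 'v \<times> 'e list \<Rightarrow> ('v \<times> 'e list) \<Rightarrow>\<^sub>0 int"
  where "path_mult G = (\<lambda>(u, p) (v, q).
    if pre_digraph.awlast G u p = v then frag_of (u, p @ q) else 0)"

text \<open>The unit below is meaningful only for finitely many vertices.\<close>

definition path_algebra :: "('v, 'e) pre_digraph \<Rightarrow> (('v \<times> 'e list) \<Rightarrow>\<^sub>0 int) ring"
  where "path_algebra G =
    \<lparr> carrier = {f. Poly_Mapping.keys f \<subseteq> paths G},
      monoid.mult = (\<lambda>f g. frag_extend (\<lambda>p. frag_extend (\<lambda>q. path_mult G p q) g) f),
      one = (\<Sum>v\<in>verts G. frag_of (v, [])),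
      zero = 0,
      add = (+) \<rparr>"


section \<open>Columns and the stylic monoid\<close>

definition columns :: "'a set \<Rightarrow> 'a set set"
  where "columns A = Pow A"

definition column_word :: "'a::linorder set \<Rightarrow> 'a list"
  where "column_word \<gamma> = rev (sorted_list_of_set \<gamma>)"

definition left_act_letter :: "'a::linorder \<Rightarrow> 'a set \<Rightarrow> 'a set"
  where "left_act_letter a \<gamma> =
    (if \<forall>y\<in>\<gamma>. y < a then insert a \<gamma>
     else insert a (\<gamma> - {Min {y \<in> \<gamma>. a \<le> y}}))"

text \<open>The last letter of the word acts first.\<close>

definition left_act :: "'a::linorder list \<Rightarrow> 'a set \<Rightarrow> 'a set"
  where "left_act w \<gamma> = foldr left_act_letter w \<gamma>"

definition \<mu> :: "'a::linorder set \<Rightarrow> 'a list \<Rightarrow> 'a set \<Rightarrow> 'a set"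
  where "\<mu> A w = restrict (left_act w) (columns A)"

definition Styl :: "'a::linorder set \<Rightarrow> ('a set \<Rightarrow> 'a set) monoid"
  where "Styl A =
    \<lparr> carrier = \<mu> A ` lists A,
      monoid.mult = compose (columns A),
      one = (\<lambda>\<gamma>\<in>columns A. \<gamma>) \<rparr>"

definition styl_equiv :: "'a::linorder set \<Rightarrow> 'a list \<Rightarrow> 'a list \<Rightarrow> bool"
  where "styl_equiv A u v \<longleftrightarrow> \<mu> A u = \<mu> A v"

abbreviation ZStyl :: "'a::linorder set \<Rightarrow> (('a set \<Rightarrow> 'a set) \<Rightarrow>\<^sub>0 int) ring"
  where "ZStyl A \<equiv> monoid_algebra (Styl A)"

definition letter :: "'a::linorder set \<Rightarrow> 'a \<Rightarrow> ('a set \<Rightarrow> 'a set) \<Rightarrow>\<^sub>0 int"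
  where "letter A a = frag_of (\<mu> A [a])"

definition list_prod :: "('r, 'x) monoid_scheme \<Rightarrow> 'r list \<Rightarrow> 'r"
  where "list_prod R xs = foldr (mult R) xs \<one>\<^bsub>R\<^esub>"

definition e_col :: "'a::linorder set \<Rightarrow> 'a set \<Rightarrow> ('a set \<Rightarrow> 'a set) \<Rightarrow>\<^sub>0 int"
  where "e_col A \<gamma> =
    list_prod (ZStyl A)
      (map (\<lambda>a. \<one>\<^bsub>ZStyl A\<^esub> \<ominus>\<^bsub>ZStyl A\<^esub> letter A a) (sorted_list_of_set (A - \<gamma>)))
    \<otimes>\<^bsub>ZStyl A\<^esub>
    list_prod (ZStyl A) (map (letter A) (rev (sorted_list_of_set \<gamma>)))"


section \<open>The quiver and the homomorphism \<open>\<phi>\<close>\<close>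

definition right_act_letter :: "'a::linorder set \<Rightarrow> 'a \<Rightarrow> 'a set"
  where "right_act_letter \<gamma> c =
    (if \<forall>x\<in>\<gamma>. c < x then insert c \<gamma>
     else insert c (\<gamma> - {Max {x \<in> \<gamma>. x \<le> c}}))"

definition frank :: "'a::linorder set \<Rightarrow> 'a \<Rightarrow> bool"
  where "frank \<gamma> c \<longleftrightarrow> \<gamma> \<noteq> {} \<and> Min \<gamma> \<le> c \<and> c \<notin> \<gamma>"

text \<open>The arc \<open>(\<gamma>, c, \<gamma>')\<close> goes from \<open>\<gamma>\<close> to \<open>\<gamma>'\<close> and has label \<open>c\<close>.\<close>

definition quiver :: "'a::linorder set \<Rightarrow> ('a set, 'a set \<times> 'a \<times> 'a set) pre_digraph"
  where "quiver A =
    \<lparr> verts = columns A,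
      arcs = {(\<gamma>, c, \<gamma>'). \<gamma> \<in> columns A \<and> c \<in> A \<and> right_act_letter \<gamma> c = \<gamma>' \<and> frank \<gamma> c},
      tail = (\<lambda>(\<gamma>, c, \<gamma>'). \<gamma>),
      head = (\<lambda>(\<gamma>, c, \<gamma>'). \<gamma>') \<rparr>"

definition label :: "('v \<times> 'a \<times> 'v) list \<Rightarrow> 'a list"
  where "label p = map (\<lambda>(\<gamma>, c, \<gamma>'). c) p"

definition \<phi>_path ::
    "'a::linorder set \<Rightarrow> 'a set \<times> ('a set \<times> 'a \<times> 'a set) list \<Rightarrow> ('a set \<Rightarrow> 'a set) \<Rightarrow>\<^sub>0 int"
  where "\<phi>_path A = (\<lambda>(\<gamma>\<^sub>0, p).
    foldl (\<lambda>x (\<gamma>, c, \<gamma>'). (x \<otimes>\<^bsub>ZStyl A\<^esub> letter A c) \<otimes>\<^bsub>ZStyl A\<^esub> e_col A \<gamma>') (e_col A \<gamma>\<^sub>0) p)"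

text \<open>
  The paths form a basis of the path algebra, so \<open>\<phi>\<close> is the linear extension of its values on
  paths.
\<close>

definition \<phi> ::
    "'a::linorder set \<Rightarrow> (('a set \<times> ('a set \<times> 'a \<times> 'a set) list) \<Rightarrow>\<^sub>0 int)
       \<Rightarrow> (('a set \<Rightarrow> 'a set) \<Rightarrow>\<^sub>0 int)"
  where "\<phi> A = frag_extend (\<phi>_path A)"

end

theory Submission
  imports Defs
begin

text \<open>
  For a word \<open>w\<close>, consider the column \<open>N(w) = w \<cdot> \<emptyset>\<close>, which depends only on \<open>\<mu>\<^sub>w\<close>. The left action is
  monotone for inclusion, and a letter fixes a column exactly when it belongs to it; therefore
  \<open>aw \<equiv> w\<close> if and only if \<open>a \<in> N(w)\<close>. For a set \<open>B\<close> of letters let \<open>\<Pi>\<^sub>B\<close> be the product of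
  the elements \<open>1 - a\<close>, \<open>a \<in> B\<close>, in increasing order.

  \<^item> If \<open>B\<close> meets \<open>N(w)\<close>, then \<open>\<Pi>\<^sub>B w = 0\<close>, because the letters larger than \<open>a\<close> never remove
    \<open>a\<close> from a column (\<open>complement_prod_mult_eq_0\<close>).

  \<^item> If \<open>B\<close> is disjoint from \<open>N(w)\<close>, then \<open>\<Pi>\<^sub>B w\<close> is \<open>w\<close> plus elements whose column has larger
    rank (\<open>keys_complement_prod_mult_diff\<close>). So the linear map
    \<open>m \<mapsto> \<Pi>\<^sub>B m\<close>, where \<open>B = A - N(m)\<close>, is unitriangular and hence injective
    (\<open>frag_extend_complement_lift_eq_0D\<close>).

  It remains to see that \<open>\<phi>\<close> is this injective map applied to \<open>\<mu>\<^bsub>\<gamma>u\<^esub>\<close>, for a path from \<open>\<gamma>\<close> with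
  label \<open>u\<close>. If \<open>c\<close> acts frankly on \<open>\<gamma>\<close>, replacing \<open>b\<close> and producing \<open>\<gamma>'\<close>, then Knuth's relations give
  \<open>\<gamma>c \<equiv> b\<gamma>'\<close> (\<open>left_act_column_frank\<close>). Two things follow. First, \<open>N(\<gamma>u) = \<gamma>\<close>, by induction on the
  path. Second, \<open>e\<^sub>\<gamma> c e\<^bsub>\<gamma>'\<^esub> = e\<^sub>\<gamma> c\<close> (\<open>e_col_frank\<close>): in the expansion of \<open>e\<^bsub>\<gamma>'\<^esub>\<close>, every term
  \<open>v\<gamma>'\<close> with \<open>v\<close> nonempty has a column of larger rank than \<open>\<gamma>'\<close>, so \<open>N(\<gamma>cv\<gamma>') \<noteq> \<gamma>\<close> and \<open>e\<^sub>\<gamma> cv\<gamma>' = 0\<close>;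
  the remaining term is \<open>\<gamma>c\<gamma>' \<equiv> b\<gamma>'\<gamma>' \<equiv> b\<gamma>' \<equiv> \<gamma>c\<close>. Consequently \<open>\<phi>\<close> sends the path to \<open>e\<^sub>\<gamma> u = \<Pi>\<^sub>B \<gamma>u\<close>
  with \<open>B = A - \<gamma> = A - N(\<gamma>u)\<close>.

  So the kernel of \<open>\<phi>\<close> is that of the linear extension of the map sending this path to \<open>\<mu>\<^bsub>\<gamma>u\<^esub>\<close>, which takes basis
  elements to basis elements. It is spanned by the differences of two paths with equal
  image, and these start at the same vertex because \<open>N\<close> recovers the vertex from the image.
\<close>

section \<open>Inserting a letter into a column\<close>

lemma left_act_letter_cases:
  assumes "finite \<delta>"
  obtains (grow) "\<forall>y\<in>\<delta>. y < a" "left_act_letter a \<delta> = insert a \<delta>"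
  | (bump) p where "p \<in> \<delta>" "a \<le> p" "\<forall>y\<in>\<delta>. y < a \<or> p \<le> y"
      "left_act_letter a \<delta> = insert a (\<delta> - {p})"
proof (cases "\<forall>y\<in>\<delta>. y < a")
  case True
  then show ?thesis by (intro grow) (auto simp: left_act_letter_def)
next
  case False
  define B where "B = {y \<in> \<delta>. a \<le> y}"
  have B: "finite B" "B \<noteq> {}" using False assms by (auto simp: B_def not_less)
  then have "Min B \<in> B" "\<forall>y\<in>B. Min B \<le> y" by auto
  moreover have "left_act_letter a \<delta> = insert a (\<delta> - {Min B})"
    unfolding left_act_letter_def B_def using False by (simp only: if_False)
  ultimately show ?thesis
    by (intro bump[of "Min B"]) (auto simp: B_def not_less)
qed

definition down_closed :: "'a::order set \<Rightarrow> bool"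
  where "down_closed D \<longleftrightarrow> (\<forall>x\<in>D. \<forall>y\<le>x. y \<in> D)"

text \<open>
  If \<open>D\<close> contains \<open>a\<close>, then the count grows, and only by one, exactly when \<open>\<delta> \<inter> D\<close> has no element
  from \<open>a\<close> upwards, that is, when it is \<open>\<delta> \<inter> {..<a}\<close>. Writing the new count as a maximum removes
  the distinction between bumping and growing, so that identities between words acting on
  columns become identities of the max-plus arithmetic of such counts.
\<close>
lemma card_left_act_letter_Int:
  fixes a :: "'a::linorder"
  assumes "finite \<delta>" and D: "down_closed D"
  shows "card (left_act_letter a \<delta> \<inter> D) =
    (if a \<in> D then max (card (\<delta> \<inter> D)) (Suc (card (\<delta> \<inter> {..<a}))) else card (\<delta> \<inter> D))"
  using \<open>finite \<delta>\<close>
proof (cases rule: left_act_letter_cases[of \<delta> a])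
  case grow
  show ?thesis
  proof (cases "a \<in> D")
    case True
    with grow D have "\<delta> \<inter> D = \<delta>" "\<delta> \<inter> {..<a} = \<delta>" "a \<notin> \<delta>"
      by (auto simp: down_closed_def less_imp_le)
    with True grow assms show ?thesis by simp
  qed (use grow in simp)
next
  case (bump p)
  show ?thesis
  proof (cases "a \<in> D")
    case a: True
    show ?thesis
    proof (cases "p \<in> D")
      case True
      have "insert p (\<delta> \<inter> {..<a}) \<subseteq> \<delta> \<inter> D"
        using bump D a True by (auto simp: down_closed_def)
      from card_mono[OF _ this] have "Suc (card (\<delta> \<inter> {..<a})) \<le> card (\<delta> \<inter> D)"
        using assms bump by simp
      moreover have "card (insert a (\<delta> - {p}) \<inter> D) = card (\<delta> \<inter> D)"
      proof -
        have eq: "insert a (\<delta> - {p}) \<inter> D = insert a ((\<delta> \<inter> D) - {p})" using a by auto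
        have "a \<notin> \<delta> \<inter> D - {p}" using bump by auto
        then show ?thesis unfolding eq using assms bump True
            card.remove[of "\<delta> \<inter> D" p] by simp
      qed
      ultimately show ?thesis using a bump by simp
    next
      case False
      have "y \<in> D \<longleftrightarrow> y < a" if "y \<in> \<delta>" for y
        using that a False bump(3) D unfolding down_closed_def by (meson less_imp_le)
      then have "\<delta> \<inter> D = \<delta> \<inter> {..<a}" by auto
      moreover have "insert a (\<delta> - {p}) \<inter> D = insert a (\<delta> \<inter> D)" using a False by auto
      ultimately show ?thesis using a bump assms by simp
    qed
  next
    case False
    with bump D have "insert a (\<delta> - {p}) \<inter> D = \<delta> \<inter> D" by (auto simp: down_closed_def)
    with bump False show ?thesis by simp
  qed
qed

lemma down_closed_atMost [simp]: "down_closed {..t}"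
  and down_closed_lessThan [simp]: "down_closed {..<t}"
  by (auto simp: down_closed_def)

lemma finite_left_act_letter [simp]: "finite \<delta> \<Longrightarrow> finite (left_act_letter a \<delta>)"
  by (simp add: left_act_letter_def)

text \<open>
  Membership of \<open>t\<close> is visible in the difference between the counts for \<open>{..t}\<close> and \<open>{..<t}\<close>.
\<close>
lemma column_eqI:
  fixes \<delta> \<epsilon> :: "'a::linorder set"
  assumes "finite \<delta>" "finite \<epsilon>"
    and eq: "\<And>D. down_closed D \<Longrightarrow> card (\<delta> \<inter> D) = card (\<epsilon> \<inter> D)"
  shows "\<delta> = \<epsilon>"
proof -
  have "t \<in> \<delta> \<longleftrightarrow> card (\<delta> \<inter> {..t}) \<noteq> card (\<delta> \<inter> {..<t})" if "finite \<delta>" for t and \<delta> :: "'a set"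
  proof (cases "t \<in> \<delta>")
    case True
    then have "\<delta> \<inter> {..t} = insert t (\<delta> \<inter> {..<t})" by auto
    with True that show ?thesis by simp
  next
    case False
    then have "\<delta> \<inter> {..t} = \<delta> \<inter> {..<t}" by (auto simp: order_le_less)
    with False show ?thesis by simp
  qed
  with assms show ?thesis by (auto simp: Set.set_eq_iff)
qed

text \<open>
  The two strict Knuth relations, \<open>yxz = yzx\<close> and \<open>xzy = zxy\<close> for \<open>x < y < z\<close>. They suffice below
  because a frank letter differs from all letters of the column that it acts on.
\<close>
lemma left_act_knuth_low:
  assumes "finite \<delta>" "x < y" "y < (z::'a::linorder)"
  shows "left_act_letter y (left_act_letter x (left_act_letter z \<delta>))
       = left_act_letter y (left_act_letter z (left_act_letter x \<delta>))"
proof (rule column_eqI)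
  fix D :: "'a set"
  assume D: "down_closed D"
  have "card (\<delta> \<inter> {..<x}) \<le> card (\<delta> \<inter> {..<y})" "card (\<delta> \<inter> {..<y}) \<le> card (\<delta> \<inter> {..<z})"
    using assms by (auto intro!: card_mono)
  moreover have "y \<in> D \<Longrightarrow> x \<in> D" "z \<in> D \<Longrightarrow> y \<in> D"
    using D assms by (auto simp: down_closed_def dest: less_imp_le)
  moreover have "card (\<delta> \<inter> {..<y}) \<le> card (\<delta> \<inter> D)" if "y \<in> D"
    using assms D that by (auto intro!: card_mono simp: down_closed_def)
  ultimately show "card (left_act_letter y (left_act_letter x (left_act_letter z \<delta>)) \<inter> D) =
      card (left_act_letter y (left_act_letter z (left_act_letter x \<delta>)) \<inter> D)"
    using assms D by (auto simp: card_left_act_letter_Int max_def)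
qed (use assms in auto)

lemma left_act_knuth_high:
  assumes "finite \<delta>" "x < y" "y < (z::'a::linorder)"
  shows "left_act_letter x (left_act_letter z (left_act_letter y \<delta>))
       = left_act_letter z (left_act_letter x (left_act_letter y \<delta>))"
proof (rule column_eqI)
  fix D :: "'a set"
  assume D: "down_closed D"
  have "card (\<delta> \<inter> {..<x}) \<le> card (\<delta> \<inter> {..<y})" "card (\<delta> \<inter> {..<y}) \<le> card (\<delta> \<inter> {..<z})"
    using assms by (auto intro!: card_mono)
  moreover have "y \<in> D \<Longrightarrow> x \<in> D" "z \<in> D \<Longrightarrow> y \<in> D"
    using D assms by (auto simp: down_closed_def dest: less_imp_le)
  ultimately show "card (left_act_letter x (left_act_letter z (left_act_letter y \<delta>)) \<inter> D) =
      card (left_act_letter z (left_act_letter x (left_act_letter y \<delta>)) \<inter> D)"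
    using assms D by (auto simp: card_left_act_letter_Int max_def)
qed (use assms in auto)

section \<open>Words acting on columns\<close>

lemma left_act_simps [simp]:
  "left_act [] \<delta> = \<delta>"
  "left_act (a # w) \<delta> = left_act_letter a (left_act w \<delta>)"
  "left_act (v @ w) \<delta> = left_act v (left_act w \<delta>)"
  by (simp_all add: left_act_def)

lemma finite_left_act [simp]: "finite \<delta> \<Longrightarrow> finite (left_act w \<delta>)"
  by (induction w) auto

lemma left_act_subset: "left_act w \<delta> \<subseteq> set w \<union> \<delta>"
  by (induction w) (auto simp: left_act_letter_def)

lemma mem_left_act_letter [simp]: "a \<in> left_act_letter a \<delta>"
  by (simp add: left_act_letter_def)

lemma mem_left_act_letter_less:
  assumes "finite \<delta>" "y \<in> \<delta>" "y < a"
  shows "y \<in> left_act_letter a \<delta>"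
  using \<open>finite \<delta>\<close> by (cases rule: left_act_letter_cases[of \<delta> a]) (use assms in auto)

lemma left_act_letter_absorb:
  assumes "finite \<delta>" "a \<in> \<delta>"
  shows "left_act_letter a \<delta> = \<delta>"
  using \<open>finite \<delta>\<close> by (cases rule: left_act_letter_cases[of \<delta> a]) (use assms in auto)

lemma left_act_absorb:
  assumes "finite \<delta>" "set w \<subseteq> \<delta>"
  shows "left_act w \<delta> = \<delta>"
  using assms(2) by (induction w) (simp_all add: left_act_letter_absorb assms(1))

lemma mem_left_act_letter_iff:
  assumes "finite \<delta>"
  shows "y \<in> left_act_letter a \<delta> \<longleftrightarrow> y = a \<or> y \<in> \<delta> \<and> (y < a \<or> (\<exists>x\<in>\<delta>. a \<le> x \<and> x < y))"
  using assms
proof (cases rule: left_act_letter_cases[of \<delta> a])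
  case (bump p)
  then have "y < a \<or> (\<exists>x\<in>\<delta>. a \<le> x \<and> x < y)" if "y \<in> \<delta>" "y \<noteq> p"
    using that by fastforce
  then show ?thesis using bump by (auto simp: not_less)
qed auto

lemma left_act_letter_mono:
  assumes "finite \<epsilon>" "\<delta> \<subseteq> \<epsilon>"
  shows "left_act_letter a \<delta> \<subseteq> left_act_letter a \<epsilon>"
proof
  fix y
  assume "y \<in> left_act_letter a \<delta>"
  moreover have "finite \<delta>" using assms finite_subset by blast
  ultimately show "y \<in> left_act_letter a \<epsilon>"
    using assms by (fastforce simp: mem_left_act_letter_iff)
qed

lemma left_act_mono:
  assumes "finite \<epsilon>" "\<delta> \<subseteq> \<epsilon>"
  shows "left_act w \<delta> \<subseteq> left_act w \<epsilon>"
  by (induction w) (simp_all add: left_act_letter_mono assms)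

lemma set_column_word [simp]: "finite \<gamma> \<Longrightarrow> set (column_word \<gamma>) = \<gamma>"
  and sorted_wrt_column_word [simp]: "sorted_wrt (>) (column_word \<gamma>)"
  by (simp_all add: column_word_def sorted_wrt_rev)

lemma column_word_set:
  assumes "sorted_wrt (>) w"
  shows "column_word (set w) = w"
proof -
  have "sorted_wrt (<) (rev w)" using assms by (simp add: sorted_wrt_rev)
  then have "sorted_list_of_set (set (rev w)) = rev w"
    by (intro sorted_list_of_set.idem_if_sorted_distinct) (simp_all add: strict_sorted_iff)
  then show ?thesis by (simp add: column_word_def)
qed

text \<open>The next letter of a decreasing word is larger than those already inserted, so it bumps none of them.\<close>
lemma subset_left_act_decreasing:
  assumes "sorted_wrt (>) w" "finite \<delta>"
  shows "set w \<subseteq> left_act w \<delta>"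
  using assms(1) by (induction w) (auto simp: assms(2) intro: mem_left_act_letter_less)

lemma subset_left_act_column:
  assumes "finite \<gamma>" "finite \<delta>"
  shows "\<gamma> \<subseteq> left_act (column_word \<gamma>) \<delta>"
  using subset_left_act_decreasing[of "column_word \<gamma>" \<delta>] assms by simp

lemma left_act_column_empty: "finite \<gamma> \<Longrightarrow> left_act (column_word \<gamma>) {} = \<gamma>"
  using left_act_subset[of "column_word \<gamma>" "{}"] subset_left_act_column[of \<gamma> "{}"] by auto

lemma left_act_column_idem:
  "finite \<gamma> \<Longrightarrow> finite \<delta> \<Longrightarrow>
    left_act (column_word \<gamma>) (left_act (column_word \<gamma>) \<delta>) = left_act (column_word \<gamma>) \<delta>"
  by (intro left_act_absorb) (simp_all add: subset_left_act_column)

section \<open>Frank actions as plactic relations\<close>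

text \<open>
  The letter \<open>c\<close> that acts frankly on a column passes, by Knuth relations, to the left of all letters
  below the letter \<open>b\<close> that it will replace; afterwards \<open>b\<close> passes to the left of all letters
  above \<open>c\<close>.
\<close>
lemma left_act_commute_low:
  assumes "sorted_wrt (>) L" "\<forall>l\<in>set L. l < b" "b < c" "finite \<delta>"
  shows "left_act (b # L) (left_act_letter c \<delta>) = left_act (b # c # L) \<delta>"
  using assms
proof (induction L arbitrary: b)
  case (Cons l L)
  then have "left_act (l # L) (left_act_letter c \<delta>) = left_act (l # c # L) \<delta>"
    by (intro Cons.IH) auto
  with Cons.prems left_act_knuth_low[of "left_act L \<delta>" l b c] show ?case by simp
qed simp

lemma left_act_commute_high:
  assumes "sorted_wrt (>) H" "\<forall>h\<in>set H. c < h" "b < c" "finite \<delta>"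
  shows "left_act (H @ [b, c]) \<delta> = left_act (b # H @ [c]) \<delta>"
  using assms
proof (induction H)
  case (Cons h H)
  then have IH: "left_act (H @ [b, c]) \<delta> = left_act (b # H @ [c]) \<delta>"
    by auto
  obtain y v where y: "H @ [c] = y # v" by (cases H) auto
  then have "y \<in> set (H @ [c])" by simp
  with Cons.prems have "b < y" "y < h" by auto
  from left_act_knuth_high[OF _ this, of "left_act v \<delta>"] IH y Cons.prems show ?case
    by (metis append_Cons finite_left_act left_act_simps(2))
qed simp

definition bumped :: "'a::linorder set \<Rightarrow> 'a \<Rightarrow> 'a"
  where "bumped \<gamma> c = Max {x \<in> \<gamma>. x \<le> c}"

lemma frank_bumped:
  assumes "finite \<gamma>" "frank \<gamma> c"
  shows "bumped \<gamma> c \<in> \<gamma>" "bumped \<gamma> c < c" "\<forall>y\<in>\<gamma>. y \<le> bumped \<gamma> c \<or> c < y"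
    and "right_act_letter \<gamma> c = insert c (\<gamma> - {bumped \<gamma> c})"
proof -
  let ?B = "{x \<in> \<gamma>. x \<le> c}"
  have B: "finite ?B" "?B \<noteq> {}" using assms Min_in by (auto simp: frank_def)
  have mem: "bumped \<gamma> c \<in> ?B" unfolding bumped_def using B by (rule Max_in)
  have max: "y \<le> bumped \<gamma> c" if "y \<in> ?B" for y
    unfolding bumped_def using B(1) that by (rule Max_ge)
  show "bumped \<gamma> c \<in> \<gamma>" using mem by simp
  then show "bumped \<gamma> c < c" using mem assms(2) by (auto simp: frank_def order_less_le)
  show "\<forall>y\<in>\<gamma>. y \<le> bumped \<gamma> c \<or> c < y" using max not_less by blast
  have "\<not> (\<forall>x\<in>\<gamma>. c < x)" using mem by (auto simp: not_less)
  then show "right_act_letter \<gamma> c = insert c (\<gamma> - {bumped \<gamma> c})"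
    unfolding right_act_letter_def bumped_def by (simp only: if_False)
qed

text \<open>
  The relation \<open>\<gamma>c \<equiv> b\<gamma>'\<close> for the frank action of \<open>c\<close> that replaces \<open>b\<close> and turns \<open>\<gamma>\<close> into \<open>\<gamma>'\<close>:
  with \<open>\<gamma> = H b L\<close> and \<open>\<gamma>' = H c L\<close> as decreasing words, it reads \<open>H b L c = H b c L = b H c L\<close>.
\<close>
lemma left_act_column_frank:
  assumes "finite \<gamma>" "frank \<gamma> c" "finite \<delta>"
  shows "left_act (column_word \<gamma>) (left_act_letter c \<delta>) =
    left_act_letter (bumped \<gamma> c) (left_act (column_word (right_act_letter \<gamma> c)) \<delta>)"
proof -
  define b where "b = bumped \<gamma> c"
  note b = frank_bumped[OF assms(1,2), folded b_def]
  define H L where "H = column_word {y \<in> \<gamma>. c < y}" and "L = column_word {y \<in> \<gamma>. y < b}"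
  have set: "set H = {y \<in> \<gamma>. c < y}" "set L = {y \<in> \<gamma>. y < b}"
    using assms(1) by (simp_all add: H_def L_def)
  have sorted: "sorted_wrt (>) H" "sorted_wrt (>) L"
    by (simp_all add: H_def L_def)
  have order: "b < h" if "c < h" for h
    using b(2) that by (rule less_trans)
  have order': "l < c" if "l < b" for l
    using that b(2) by (rule less_trans)
  have "\<gamma> = set (H @ b # L)" "right_act_letter \<gamma> c = set (H @ c # L)"
    unfolding b(4) using set b(1-3) by force+
  moreover have "sorted_wrt (>) (H @ b # L)" "sorted_wrt (>) (H @ c # L)"
    using sorted order order' by (auto simp: sorted_wrt_append set intro: less_trans)
  ultimately have words: "column_word \<gamma> = H @ b # L" "column_word (right_act_letter \<gamma> c) = H @ c # L"
    by (metis column_word_set)+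
  have "left_act (column_word \<gamma>) (left_act_letter c \<delta>) = left_act H (left_act (b # L) (left_act_letter c \<delta>))"
    by (simp add: words)
  also have "\<dots> = left_act (H @ [b, c]) (left_act L \<delta>)"
    using left_act_commute_low[of L b c \<delta>] sorted set b assms(3) by simp
  also have "\<dots> = left_act (b # H @ [c]) (left_act L \<delta>)"
    using left_act_commute_high[of H c b] sorted set b assms(3) by simp
  finally show ?thesis by (simp add: words b_def)
qed

lemma left_act_letter_bumped:
  assumes "finite \<gamma>" "frank \<gamma> c"
  shows "left_act_letter (bumped \<gamma> c) (right_act_letter \<gamma> c) = \<gamma>"
proof -
  note b = frank_bumped[OF assms]
  have "finite (right_act_letter \<gamma> c)" using assms b by simp
  then show ?thesis
    by (cases rule: left_act_letter_cases[of _ "bumped \<gamma> c"])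
       (use b assms in \<open>force simp: frank_def\<close>)+
qed

section \<open>A rank that no letter decreases\<close>

text \<open>
  A letter that acts on a column enlarges it or replaces an element by a smaller one. Counting the
  elements up to \<open>t\<close>, for all thresholds \<open>t\<close> in \<open>A\<close>, rewards both, so this statistic makes the
  action triangular.
\<close>
definition column_rank :: "'a::linorder set \<Rightarrow> 'a set \<Rightarrow> nat"
  where "column_rank A \<delta> = (\<Sum>t\<in>A. card (\<delta> \<inter> {..t}))"

lemma column_rank_left_act_letter_le:
  assumes "finite \<delta>"
  shows "column_rank A \<delta> \<le> column_rank A (left_act_letter a \<delta>)"
  unfolding column_rank_def by (intro sum_mono) (simp add: card_left_act_letter_Int assms)

lemma column_rank_left_act_le:
  assumes "finite \<delta>"
  shows "column_rank A \<delta> \<le> column_rank A (left_act w \<delta>)"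
proof (induction w)
  case (Cons a w)
  also have "column_rank A (left_act w \<delta>) \<le> column_rank A (left_act (a # w) \<delta>)"
    by (simp add: column_rank_left_act_letter_le assms)
  finally show ?case .
qed simp

lemma column_rank_left_act_letter_less:
  assumes "finite A" "finite \<delta>" "a \<in> A" "a \<notin> \<delta>"
  shows "column_rank A \<delta> < column_rank A (left_act_letter a \<delta>)"
proof -
  have "\<delta> \<inter> {..a} = \<delta> \<inter> {..<a}" using assms(4) by (auto simp: order_le_less)
  then have "card (\<delta> \<inter> {..a}) < card (left_act_letter a \<delta> \<inter> {..a})"
    by (simp add: card_left_act_letter_Int assms(2))
  then show ?thesis
    unfolding column_rank_def using assms
    by (intro sum_strict_mono_ex1) (auto simp: card_left_act_letter_Int)
qed

lemma card_left_act_letter_le: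
  assumes "finite \<delta>"
  shows "card \<delta> \<le> card (left_act_letter a \<delta>)"
  using card_left_act_letter_Int[OF assms, of UNIV a] by (simp add: down_closed_def)

text \<open>
  In \<open>\<gamma>c\<delta> = b\<gamma>'\<delta>\<close> the column \<open>\<gamma>'\<delta>\<close> contains \<open>\<gamma>'\<close>, which has as many elements as \<open>\<gamma>\<close>, and acting by
  \<open>b\<close> cannot shrink it. So if the result is only \<open>\<gamma>\<close>, then \<open>\<gamma>'\<delta>\<close> is only \<open>\<gamma>'\<close>.
\<close>
lemma frank_left_act_eqD:
  assumes "finite \<gamma>" "frank \<gamma> c" "finite \<delta>"
    and eq: "left_act (column_word \<gamma>) (left_act_letter c \<delta>) = \<gamma>"
  shows "left_act (column_word (right_act_letter \<gamma> c)) \<delta> = right_act_letter \<gamma> c"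
proof -
  define \<gamma>' \<eta> where "\<gamma>' = right_act_letter \<gamma> c" and "\<eta> = left_act (column_word \<gamma>') \<delta>"
  note b = frank_bumped[OF assms(1,2)]
  have fin: "finite \<gamma>'" using assms(1) b by (simp add: \<gamma>'_def)
  have "card \<gamma>' = card \<gamma>"
    using b(1,2) assms(1,2) card.remove[of \<gamma> "bumped \<gamma> c"] unfolding \<gamma>'_def b(4)
    by (simp add: frank_def)
  moreover have "card \<eta> \<le> card \<gamma>"
    using card_left_act_letter_le[of \<eta> "bumped \<gamma> c"] eq assms(3)
      left_act_column_frank[OF assms(1-3)] by (simp add: \<eta>_def \<gamma>'_def)
  moreover have "\<gamma>' \<subseteq> \<eta>" "finite \<eta>"
    using fin assms(3) by (simp_all add: \<eta>_def subset_left_act_column)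
  ultimately show ?thesis unfolding \<gamma>'_def[symmetric] \<eta>_def[symmetric]
    using card_seteq[of \<eta> \<gamma>'] by simp
qed

section \<open>Monoid algebras over the integers\<close>

lemma frag_extend_fun_diff:
  fixes f g :: "'b \<Rightarrow> 'a \<Rightarrow>\<^sub>0 int"
  shows "frag_extend (\<lambda>x. f x - g x) c = frag_extend f c - frag_extend g c"
proof -
  have "frag_cmul k (a - b) = frag_cmul k a - frag_cmul k b" for k and a b :: "'a \<Rightarrow>\<^sub>0 int"
    by (rule poly_mapping_eqI) (simp add: lookup_minus algebra_simps)
  then show ?thesis by (simp add: frag_extend_def sum_subtractf)
qed

lemma keys_diff_subset:
  "Poly_Mapping.keys f \<subseteq> S \<Longrightarrow> Poly_Mapping.keys g \<subseteq> S \<Longrightarrow> Poly_Mapping.keys (f - g) \<subseteq> S"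
  using keys_diff by fast

lemma monoid_algebra_simps [simp]:
  "carrier (monoid_algebra M) = {f. Poly_Mapping.keys f \<subseteq> carrier M}"
  "\<one>\<^bsub>monoid_algebra M\<^esub> = frag_of \<one>\<^bsub>M\<^esub>"
  "\<zero>\<^bsub>monoid_algebra M\<^esub> = 0"
  "f \<oplus>\<^bsub>monoid_algebra M\<^esub> g = f + g"
  by (simp_all add: monoid_algebra_def)

lemma monoid_algebra_mult_of [simp]:
  "frag_of x \<otimes>\<^bsub>monoid_algebra M\<^esub> frag_of y = frag_of (x \<otimes>\<^bsub>M\<^esub> y)"
  by (simp add: monoid_algebra_def)

lemma monoid_algebra_mult_0 [simp]:
  "0 \<otimes>\<^bsub>monoid_algebra M\<^esub> f = 0" "f \<otimes>\<^bsub>monoid_algebra M\<^esub> 0 = 0"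
  by (simp_all add: monoid_algebra_def frag_extend_eq_0)

lemma monoid_algebra_mult_diff:
  "(f - g) \<otimes>\<^bsub>monoid_algebra M\<^esub> h = f \<otimes>\<^bsub>monoid_algebra M\<^esub> h - g \<otimes>\<^bsub>monoid_algebra M\<^esub> h"
  "f \<otimes>\<^bsub>monoid_algebra M\<^esub> (g - h) = f \<otimes>\<^bsub>monoid_algebra M\<^esub> g - f \<otimes>\<^bsub>monoid_algebra M\<^esub> h"
  by (simp_all add: monoid_algebra_def frag_extend_diff frag_extend_fun_diff)

lemma monoid_algebra_mult_add:
  "(f + g) \<otimes>\<^bsub>monoid_algebra M\<^esub> h = f \<otimes>\<^bsub>monoid_algebra M\<^esub> h + g \<otimes>\<^bsub>monoid_algebra M\<^esub> h"
  "f \<otimes>\<^bsub>monoid_algebra M\<^esub> (g + h) = f \<otimes>\<^bsub>monoid_algebra M\<^esub> g + f \<otimes>\<^bsub>monoid_algebra M\<^esub> h"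
  using monoid_algebra_mult_diff(1)[of M f "- g" h] monoid_algebra_mult_diff(1)[of M 0 g h]
    monoid_algebra_mult_diff(2)[of M f g "- h"] monoid_algebra_mult_diff(2)[of M f 0 h]
  by simp_all

context Group.monoid
begin

lemma monoid_algebra_mult_closed:
  assumes "Poly_Mapping.keys f \<subseteq> carrier G" "Poly_Mapping.keys g \<subseteq> carrier G"
  shows "Poly_Mapping.keys (f \<otimes>\<^bsub>monoid_algebra G\<^esub> g) \<subseteq> carrier G"
  using assms(1)
proof (induction f rule: frag_induction)
  case (one x)
  from assms(2) show ?case
  proof (induction g rule: frag_induction)
    case (diff a b)
    then show ?case by (simp add: monoid_algebra_mult_diff keys_diff_subset)
  qed (use one in \<open>auto simp: keys_frag_of\<close>)
next
  case (diff a b)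
  then show ?case by (simp add: monoid_algebra_mult_diff keys_diff_subset)
qed simp

lemma monoid_algebra_mult_assoc:
  assumes f: "Poly_Mapping.keys f \<subseteq> carrier G" and g: "Poly_Mapping.keys g \<subseteq> carrier G"
    and h: "Poly_Mapping.keys h \<subseteq> carrier G"
  shows "f \<otimes>\<^bsub>monoid_algebra G\<^esub> g \<otimes>\<^bsub>monoid_algebra G\<^esub> h
    = f \<otimes>\<^bsub>monoid_algebra G\<^esub> (g \<otimes>\<^bsub>monoid_algebra G\<^esub> h)"
  using f
proof (induction f rule: frag_induction)
  case (one x)
  show ?case using g
  proof (induction g rule: frag_induction)
    case (one y)
    show ?case using h
      by (induction h rule: frag_induction)
        (simp_all add: monoid_algebra_mult_diff m_assoc \<open>x \<in> carrier G\<close> one)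
  qed (simp_all add: monoid_algebra_mult_diff)
qed (simp_all add: monoid_algebra_mult_diff)

lemma monoid_algebra_one:
  assumes "Poly_Mapping.keys f \<subseteq> carrier G"
  shows "frag_of \<one> \<otimes>\<^bsub>monoid_algebra G\<^esub> f = f" "f \<otimes>\<^bsub>monoid_algebra G\<^esub> frag_of \<one> = f"
  using assms by (induction f rule: frag_induction) (simp_all add: monoid_algebra_mult_diff)

lemma ring_monoid_algebra: "ring (monoid_algebra G)"
proof (rule ringI)
  show "abelian_group (monoid_algebra G)"
  proof (rule abelian_groupI)
    fix f assume "f \<in> carrier (monoid_algebra G)"
    then show "\<exists>g\<in>carrier (monoid_algebra G). g \<oplus>\<^bsub>monoid_algebra G\<^esub> f = \<zero>\<^bsub>monoid_algebra G\<^esub>"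
      by (intro bexI[of _ "- f"]) auto
  qed (auto simp: add.assoc add.commute dest!: subsetD[OF keys_add])
  show "Group.monoid (monoid_algebra G)"
    by (rule Group.monoidI)
      (simp_all add: monoid_algebra_mult_closed monoid_algebra_mult_assoc monoid_algebra_one keys_frag_of)
qed (simp_all add: monoid_algebra_mult_add)

lemma monoid_algebra_minus:
  assumes "Poly_Mapping.keys f \<subseteq> carrier G" "Poly_Mapping.keys g \<subseteq> carrier G"
  shows "f \<ominus>\<^bsub>monoid_algebra G\<^esub> g = f - g"
proof -
  interpret R: ring "monoid_algebra G" by (rule ring_monoid_algebra)
  have "\<ominus>\<^bsub>monoid_algebra G\<^esub> g = - g"
    using assms(2) by (intro R.minus_equality) simp_all
  then show ?thesis by (simp add: R.minus_eq)
qed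

end

lemma (in Group.monoid) list_prod_closed:
  "set xs \<subseteq> carrier G \<Longrightarrow> list_prod G xs \<in> carrier G"
  by (induction xs) (auto simp: list_prod_def)

lemma (in Group.monoid) list_prod_append:
  assumes "set xs \<subseteq> carrier G" "set ys \<subseteq> carrier G"
  shows "list_prod G (xs @ ys) = list_prod G xs \<otimes> list_prod G ys"
  using assms(1)
proof (induction xs)
  case (Cons x xs)
  then show ?case using list_prod_closed[of xs] list_prod_closed[OF assms(2)]
    by (auto simp: list_prod_def m_assoc)
qed (use list_prod_closed[OF assms(2)] in \<open>simp add: list_prod_def\<close>)

section \<open>Linear maps given on a basis\<close>

text \<open>
  At a basis element \<open>m\<close> of minimal rank in the support of \<open>f\<close>, the image of \<open>f\<close> has the same
  coefficient as \<open>f\<close>.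
\<close>
lemma frag_extend_unitriangular_eq_0D:
  fixes r :: "'b \<Rightarrow> nat"
  assumes upper: "\<And>m. m \<in> Poly_Mapping.keys f \<Longrightarrow>
      Poly_Mapping.keys (\<theta> m - frag_of m) \<subseteq> {m'. r m < r m'}"
    and "frag_extend \<theta> f = 0"
  shows "f = 0"
proof (rule ccontr)
  assume "f \<noteq> 0"
  then obtain m where m: "m \<in> Poly_Mapping.keys f" by fastforce
  define m0 where "m0 = arg_min r (\<lambda>m. m \<in> Poly_Mapping.keys f)"
  have m0: "m0 \<in> Poly_Mapping.keys f" "\<And>m. m \<in> Poly_Mapping.keys f \<Longrightarrow> r m0 \<le> r m"
    unfolding m0_def using m by (auto intro: arg_min_natI arg_min_nat_le)
  let ?rest = "frag_extend (\<lambda>m. \<theta> m - frag_of m) f"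
  have "m0 \<notin> Poly_Mapping.keys ?rest"
  proof
    assume "m0 \<in> Poly_Mapping.keys ?rest"
    then obtain m where "m \<in> Poly_Mapping.keys f" "m0 \<in> Poly_Mapping.keys (\<theta> m - frag_of m)"
      using keys_frag_extend by fast
    with upper m0(2) show False by fastforce
  qed
  moreover have "?rest = - f"
    using assms(2) by (simp add: frag_extend_fun_diff flip: frag_expansion)
  ultimately show False using m0(1) by simp
qed

text \<open>
  The kernel of a linear map that sends basis elements to basis elements: replacing each basis
  element by a fixed representative of its fibre changes \<open>f\<close> by a combination of the generators,
  and the representatives' coefficients are those of the image of \<open>f\<close>, hence zero.
\<close>
lemma frag_extend_eq_0_imp_span:
  assumes keys: "Poly_Mapping.keys f \<subseteq> P"
    and zero: "frag_extend (\<lambda>x. frag_of (\<pi> x)) f = 0"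
  shows "f \<in> frag.span {frag_of x - frag_of y | x y. x \<in> P \<and> y \<in> P \<and> \<pi> x = \<pi> y}"
proof -
  define rep where "rep = (\<lambda>m. SOME y. y \<in> P \<and> \<pi> y = m)"
  have rep: "rep (\<pi> x) \<in> P" "\<pi> (rep (\<pi> x)) = \<pi> x" if "x \<in> P" for x
    using someI[of "\<lambda>y. y \<in> P \<and> \<pi> y = \<pi> x" x] that by (auto simp: rep_def)
  have "frag_extend (\<lambda>x. frag_of (rep (\<pi> x))) f =
      frag_extend (\<lambda>m. frag_of (rep m)) (frag_extend (\<lambda>x. frag_of (\<pi> x)) f)"
    using keys by (induction f rule: frag_induction) (simp_all add: frag_extend_diff)
  with zero have "f = frag_extend (\<lambda>x. frag_of x - frag_of (rep (\<pi> x))) f"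
    by (simp add: frag_extend_fun_diff flip: frag_expansion)
  also have "\<dots> \<in> frag.span {frag_of x - frag_of y | x y. x \<in> P \<and> y \<in> P \<and> \<pi> x = \<pi> y}"
    unfolding frag_extend_def
  proof (intro frag.span_sum frag.span_scale frag.span_base)
    fix x assume "x \<in> Poly_Mapping.keys f"
    with keys have "x \<in> P" by blast
    with rep[of x] show "frag_of x - frag_of (rep (\<pi> x)) \<in>
        {frag_of x - frag_of y | x y. x \<in> P \<and> y \<in> P \<and> \<pi> x = \<pi> y}"
      by (intro CollectI exI[of _ x] exI[of _ "rep (\<pi> x)"]) simp
  qed
  finally show ?thesis .
qed

section \<open>The stylic algebra\<close>

(* From here on, carriers and products of the algebra stay folded, so that the simplifier can use
   the ring laws. *)
declare monoid_algebra_simps [simp del] monoid_algebra_mult_of [simp del]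

lemma left_act_columns:
  assumes "w \<in> lists A" "\<gamma> \<in> columns A"
  shows "left_act w \<gamma> \<in> columns A"
  using assms left_act_subset[of w \<gamma>] by (auto simp: columns_def)

lemma mult_\<mu>:
  assumes "v \<in> lists A"
  shows "\<mu> A u \<otimes>\<^bsub>Styl A\<^esub> \<mu> A v = \<mu> A (u @ v)"
  using left_act_columns[OF assms]
  by (auto simp: Styl_def \<mu>_def compose_def fun_eq_iff)

lemma one_Styl: "\<one>\<^bsub>Styl A\<^esub> = \<mu> A []"
  by (auto simp: Styl_def \<mu>_def fun_eq_iff)

lemma carrier_Styl: "carrier (Styl A) = \<mu> A ` lists A"
  by (simp add: Styl_def)

lemma monoid_Styl: "Group.monoid (Styl A)"
proof (rule Group.monoidI)
  show "x \<otimes>\<^bsub>Styl A\<^esub> y \<in> carrier (Styl A)"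
    if "x \<in> carrier (Styl A)" "y \<in> carrier (Styl A)" for x y
    using that unfolding carrier_Styl
    by (elim imageE) (simp add: mult_\<mu> image_eqI[where x = "_ @ _"])
  show "\<one>\<^bsub>Styl A\<^esub> \<in> carrier (Styl A)"
    by (simp add: one_Styl carrier_Styl)
qed (auto simp: carrier_Styl mult_\<mu> one_Styl simp flip: in_lists_conv_set)

lemma ring_ZStyl: "ring (ZStyl A)"
  by (intro monoid.ring_monoid_algebra monoid_Styl)

abbreviation word_elt :: "'a::linorder set \<Rightarrow> 'a list \<Rightarrow> ('a set \<Rightarrow> 'a set) \<Rightarrow>\<^sub>0 int"
  where "word_elt A w \<equiv> frag_of (\<mu> A w)"

definition complement_prod :: "'a::linorder set \<Rightarrow> 'a list \<Rightarrow> ('a set \<Rightarrow> 'a set) \<Rightarrow>\<^sub>0 int"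
  where "complement_prod A as =
    list_prod (ZStyl A) (map (\<lambda>a. \<one>\<^bsub>ZStyl A\<^esub> \<ominus>\<^bsub>ZStyl A\<^esub> letter A a) as)"

lemma word_elt_closed [simp]:
  "w \<in> lists A \<Longrightarrow> word_elt A w \<in> carrier (ZStyl A)"
  by (simp add: monoid_algebra_simps keys_frag_of carrier_Styl)

lemma word_elt_mult [simp]:
  "v \<in> lists A \<Longrightarrow> word_elt A u \<otimes>\<^bsub>ZStyl A\<^esub> word_elt A v = word_elt A (u @ v)"
  by (simp add: mult_\<mu> monoid_algebra_mult_of)

lemma one_ZStyl: "\<one>\<^bsub>ZStyl A\<^esub> = word_elt A []"
  by (simp add: monoid_algebra_simps one_Styl)

lemma column_word_lists:
  assumes "finite A" "\<gamma> \<subseteq> A"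
  shows "column_word \<gamma> \<in> lists A"
  using assms(2) finite_subset[OF assms(2,1)] by (auto simp: in_lists_conv_set)

lemma \<mu>_empty [simp]: "\<mu> A w {} = left_act w {}"
  by (simp add: \<mu>_def columns_def)

lemma list_prod_letters:
  "w \<in> lists A \<Longrightarrow> list_prod (ZStyl A) (map (letter A) w) = word_elt A w"
  by (induction w) (simp_all add: list_prod_def one_ZStyl letter_def)

text \<open>
  Every column contains the empty one, so by monotonicity a letter of \<open>w \<cdot> \<emptyset>\<close> lies in all columns
  \<open>w \<cdot> \<gamma>\<close>, and it acts trivially on each of them.
\<close>
lemma \<mu>_Cons_absorb:
  assumes "finite A" "a \<in> left_act w {}"
  shows "\<mu> A (a # w) = \<mu> A w"
proof
  fix \<gamma>
  show "\<mu> A (a # w) \<gamma> = \<mu> A w \<gamma>"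
  proof (cases "\<gamma> \<in> columns A")
    case True
    then have fin: "finite \<gamma>" using assms(1) finite_subset by (auto simp: columns_def)
    then have "a \<in> left_act w \<gamma>" using left_act_mono[of \<gamma> "{}" w] assms(2) by auto
    with fin show ?thesis by (simp add: \<mu>_def left_act_letter_absorb)
  qed (simp add: \<mu>_def)
qed

context
  fixes A :: "'a::linorder set"
begin

interpretation ZS: ring "ZStyl A" by (rule ring_ZStyl)

lemma complement_factor:
  assumes "a \<in> A"
  shows "\<one>\<^bsub>ZStyl A\<^esub> \<ominus>\<^bsub>ZStyl A\<^esub> letter A a = word_elt A [] - word_elt A [a]"
    and "\<one>\<^bsub>ZStyl A\<^esub> \<ominus>\<^bsub>ZStyl A\<^esub> letter A a \<in> carrier (ZStyl A)"
proof -
  have letter: "letter A a \<in> carrier (ZStyl A)" using assms by (simp add: letter_def)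
  then show "\<one>\<^bsub>ZStyl A\<^esub> \<ominus>\<^bsub>ZStyl A\<^esub> letter A a \<in> carrier (ZStyl A)" by simp
  show "\<one>\<^bsub>ZStyl A\<^esub> \<ominus>\<^bsub>ZStyl A\<^esub> letter A a = word_elt A [] - word_elt A [a]"
    using monoid.monoid_algebra_minus[OF monoid_Styl, of "\<one>\<^bsub>ZStyl A\<^esub>" A "letter A a"] letter ZS.one_closed
    unfolding monoid_algebra_simps(1) by (simp add: one_ZStyl letter_def)
qed

lemma complement_prod_closed:
  assumes "set as \<subseteq> A"
  shows "complement_prod A as \<in> carrier (ZStyl A)"
  unfolding complement_prod_def
  by (intro ZS.list_prod_closed) (use assms complement_factor(2) in auto)

lemma complement_prod_Nil_mult:
  "X \<in> carrier (ZStyl A) \<Longrightarrow> complement_prod A [] \<otimes>\<^bsub>ZStyl A\<^esub> X = X"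
  by (simp add: complement_prod_def list_prod_def)

text \<open>
  The rightmost factor acts first; splitting it off is the induction step of all the following
  expansions.
\<close>
lemma complement_prod_snoc_mult:
  assumes "set as \<subseteq> A" "a \<in> A" "w \<in> lists A"
  shows "complement_prod A (as @ [a]) \<otimes>\<^bsub>ZStyl A\<^esub> word_elt A w =
    complement_prod A as \<otimes>\<^bsub>ZStyl A\<^esub> word_elt A w
    - complement_prod A as \<otimes>\<^bsub>ZStyl A\<^esub> word_elt A (a # w)"
proof -
  let ?f = "\<one>\<^bsub>ZStyl A\<^esub> \<ominus>\<^bsub>ZStyl A\<^esub> letter A a"
  have "complement_prod A (as @ [a]) = complement_prod A as \<otimes>\<^bsub>ZStyl A\<^esub> list_prod (ZStyl A) [?f]"
    unfolding complement_prod_def map_append list.map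
    using assms(1,2) complement_factor(2) by (intro ZS.list_prod_append) auto
  also have "list_prod (ZStyl A) [?f] = ?f"
    using complement_factor(2)[OF assms(2)] by (simp add: list_prod_def)
  finally have "complement_prod A (as @ [a]) \<otimes>\<^bsub>ZStyl A\<^esub> word_elt A w =
      complement_prod A as \<otimes>\<^bsub>ZStyl A\<^esub> (?f \<otimes>\<^bsub>ZStyl A\<^esub> word_elt A w)"
    using complement_factor(2)[OF assms(2)] assms(1,3) complement_prod_closed
    by (simp add: ZS.m_assoc)
  then show ?thesis
    using assms by (simp add: complement_factor(1) monoid_algebra_mult_diff)
qed

lemma e_col_eq:
  assumes "finite A" "\<gamma> \<subseteq> A"
  shows "e_col A \<gamma> =
    complement_prod A (sorted_list_of_set (A - \<gamma>)) \<otimes>\<^bsub>ZStyl A\<^esub> word_elt A (column_word \<gamma>)"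
  using column_word_lists[OF assms]
  by (simp add: e_col_def complement_prod_def list_prod_letters flip: column_word_def)

lemma keys_complement_prod_mult:
  assumes "set as \<subseteq> A" "w \<in> lists A"
  shows "Poly_Mapping.keys (complement_prod A as \<otimes>\<^bsub>ZStyl A\<^esub> word_elt A w)
    \<subseteq> {m. column_rank A (left_act w {}) \<le> column_rank A (m {})}"
  using assms
proof (induction as arbitrary: w rule: rev_induct)
  case Nil
  then show ?case by (simp add: complement_prod_Nil_mult keys_frag_of)
next
  case (snoc a as)
  have "column_rank A (left_act w {}) \<le> column_rank A (left_act (a # w) {})"
    by (simp add: column_rank_left_act_letter_le)
  then have "Poly_Mapping.keys (complement_prod A as \<otimes>\<^bsub>ZStyl A\<^esub> word_elt A (a # w))
      \<subseteq> {m. column_rank A (left_act w {}) \<le> column_rank A (m {})}"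
    using snoc.IH[of "a # w"] snoc.prems by (auto intro: order_trans)
  with snoc.IH[of w] snoc.prems show ?case
    by (simp add: complement_prod_snoc_mult keys_diff_subset)
qed

text \<open>
  The leading term: when \<open>w \<cdot> \<emptyset>\<close> contains none of the letters, every other term of the expansion
  has a first acting letter that is new to that column, and this raises the rank.
\<close>
lemma keys_complement_prod_mult_diff:
  assumes "finite A" "set as \<subseteq> A - left_act w {}" "w \<in> lists A"
  shows "Poly_Mapping.keys (complement_prod A as \<otimes>\<^bsub>ZStyl A\<^esub> word_elt A w - word_elt A w)
    \<subseteq> {m. column_rank A (left_act w {}) < column_rank A (m {})}"
  using assms(2)
proof (induction as rule: rev_induct)
  case Nil
  then show ?case using assms(3) by (simp add: complement_prod_Nil_mult)
next
  case (snoc a as)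
  let ?P = "\<lambda>v. complement_prod A as \<otimes>\<^bsub>ZStyl A\<^esub> word_elt A v"
  have "column_rank A (left_act w {}) < column_rank A (left_act (a # w) {})"
    using assms(1) snoc.prems by (simp add: column_rank_left_act_letter_less)
  moreover have "Poly_Mapping.keys (?P (a # w))
      \<subseteq> {m. column_rank A (left_act (a # w) {}) \<le> column_rank A (m {})}"
    using snoc.prems assms(3) by (intro keys_complement_prod_mult) auto
  ultimately have "Poly_Mapping.keys (?P (a # w))
      \<subseteq> {m. column_rank A (left_act w {}) < column_rank A (m {})}"
    by (auto intro: less_le_trans)
  moreover have "Poly_Mapping.keys (?P w - word_elt A w)
      \<subseteq> {m. column_rank A (left_act w {}) < column_rank A (m {})}"
    using snoc by simp
  moreover have "complement_prod A (as @ [a]) \<otimes>\<^bsub>ZStyl A\<^esub> word_elt A w - word_elt A w =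
      (?P w - word_elt A w) - ?P (a # w)"
    using snoc.prems assms(3) by (subst complement_prod_snoc_mult) auto
  ultimately show ?case
    by (simp only: keys_diff_subset)
qed

text \<open>
  The factors to the right of \<open>1 - a\<close> involve letters larger than \<open>a\<close>, which never remove \<open>a\<close>
  from a column. So \<open>1 - a\<close> is multiplied on the right by a combination of words that absorb \<open>a\<close>. The increasing order
  of the factors in \<open>e\<^sub>\<gamma>\<close> is what makes this work.
\<close>
lemma complement_prod_mult_eq_0:
  assumes "finite A" "sorted_wrt (<) as" "set as \<subseteq> A" "w \<in> lists A"
    and "a \<in> set as" "a \<in> left_act w {}"
  shows "complement_prod A as \<otimes>\<^bsub>ZStyl A\<^esub> word_elt A w = 0"
  using assms(2-6)
proof (induction as arbitrary: w rule: rev_induct)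
  case (snoc b as)
  show ?case
  proof (cases "a = b")
    case True
    with snoc.prems show ?thesis
      by (simp add: complement_prod_snoc_mult \<mu>_Cons_absorb[OF assms(1)])
  next
    case False
    with snoc.prems have "a \<in> set as" "a < b" by (auto simp: sorted_wrt_append)
    moreover from this snoc.prems have "a \<in> left_act (b # w) {}"
      by (simp add: mem_left_act_letter_less)
    ultimately show ?thesis
      using snoc.prems snoc.IH[of w] snoc.IH[of "b # w"]
      by (simp add: complement_prod_snoc_mult sorted_wrt_append)
  qed
qed simp

lemma e_col_closed:
  assumes "finite A" "\<gamma> \<subseteq> A"
  shows "e_col A \<gamma> \<in> carrier (ZStyl A)"
  unfolding e_col_eq[OF assms] using assms
  by (intro ZS.m_closed complement_prod_closed word_elt_closed column_word_lists) auto

lemma e_col_mult_word: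
  assumes "finite A" "\<gamma> \<subseteq> A" "w \<in> lists A"
  shows "e_col A \<gamma> \<otimes>\<^bsub>ZStyl A\<^esub> word_elt A w =
    complement_prod A (sorted_list_of_set (A - \<gamma>)) \<otimes>\<^bsub>ZStyl A\<^esub> word_elt A (column_word \<gamma> @ w)"
  using assms
  by (simp add: e_col_eq ZS.m_assoc complement_prod_closed column_word_lists)

text \<open>
  The column \<open>\<gamma>w \<cdot> \<emptyset>\<close> always contains \<open>\<gamma>\<close>; if it is larger, then one of the factors \<open>1 - a\<close> of
  \<open>e\<^sub>\<gamma>\<close> kills \<open>\<gamma>w\<close>.
\<close>
lemma e_col_mult_word_eq_0:
  assumes "finite A" "\<gamma> \<subseteq> A" "w \<in> lists A" "left_act (column_word \<gamma> @ w) {} \<noteq> \<gamma>"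
  shows "e_col A \<gamma> \<otimes>\<^bsub>ZStyl A\<^esub> word_elt A w = 0"
proof -
  have fin: "finite \<gamma>" using assms finite_subset by blast
  have w: "column_word \<gamma> @ w \<in> lists A" using assms column_word_lists by auto
  have "left_act (column_word \<gamma> @ w) {} \<subseteq> A"
    using left_act_columns[OF w, of "{}"] by (simp add: columns_def)
  moreover have "\<gamma> \<subseteq> left_act (column_word \<gamma> @ w) {}"
    using fin by (simp add: subset_left_act_column)
  ultimately obtain a where "a \<in> A - \<gamma>" "a \<in> left_act (column_word \<gamma> @ w) {}"
    using assms(4) by blast
  then show ?thesis
    using assms w by (subst e_col_mult_word)
      (auto intro!: complement_prod_mult_eq_0[of _ _ a])
qed

end

section \<open>Paths of the quiver\<close>

lemma paths_quiver_Cons: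
  assumes "(\<gamma>, e # p) \<in> paths (quiver A)"
  obtains c where "e = (\<gamma>, c, right_act_letter \<gamma> c)" "\<gamma> \<subseteq> A" "c \<in> A" "frank \<gamma> c"
    "(right_act_letter \<gamma> c, p) \<in> paths (quiver A)"
proof -
  from assms obtain v where walk: "\<gamma> \<in> columns A" "e \<in> arcs (quiver A)" "set p \<subseteq> arcs (quiver A)"
      "tail (quiver A) e = \<gamma>" "pre_digraph.cas (quiver A) (head (quiver A) e) p v"
    by (auto simp: paths_def pre_digraph.awalk_def pre_digraph.cas.simps quiver_def)
  then obtain c where c: "e = (\<gamma>, c, right_act_letter \<gamma> c)" "c \<in> A" "frank \<gamma> c"
    by (auto simp: quiver_def)
  have "right_act_letter \<gamma> c \<in> columns A"
    using walk(1) c(2) by (auto simp: columns_def right_act_letter_def)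
  with walk c have "(right_act_letter \<gamma> c, p) \<in> paths (quiver A)"
    by (auto simp: paths_def pre_digraph.awalk_def quiver_def)
  with that c walk(1) show ?thesis by (simp add: columns_def)
qed

lemma paths_quiver_columns: "(\<gamma>, p) \<in> paths (quiver A) \<Longrightarrow> \<gamma> \<subseteq> A"
  by (auto simp: paths_def pre_digraph.awalk_def quiver_def columns_def)

lemma label_simps [simp]: "label [] = []" "label ((\<gamma>, c, \<gamma>') # p) = c # label p"
  by (simp_all add: label_def)

lemma label_paths_quiver:
  "(\<gamma>, p) \<in> paths (quiver A) \<Longrightarrow> label p \<in> lists A"
proof (induction p arbitrary: \<gamma>)
  case (Cons e p)
  from Cons.prems obtain c where "e = (\<gamma>, c, right_act_letter \<gamma> c)" "c \<in> A"
    "(right_act_letter \<gamma> c, p) \<in> paths (quiver A)" by (rule paths_quiver_Cons)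
  with Cons.IH show ?case by simp
qed simp

text \<open>
  The initial vertex of a path is recovered from the word \<open>\<gamma>u\<close>. Induction over the path: if \<open>u = cu'\<close> then
  \<open>\<gamma>cu' \<equiv> b\<gamma>'u'\<close>, where \<open>\<gamma>'u' \<cdot> \<emptyset> = \<gamma>'\<close>, and \<open>b\<close> acting on \<open>\<gamma>'\<close> undoes the replacement of
  \<open>b\<close> by \<open>c\<close>.
\<close>
lemma left_act_column_path_label:
  assumes "finite A" "(\<gamma>, p) \<in> paths (quiver A)"
  shows "left_act (column_word \<gamma> @ label p) {} = \<gamma>"
  using assms(2)
proof (induction p arbitrary: \<gamma>)
  case Nil
  then have "finite \<gamma>" using assms(1) paths_quiver_columns finite_subset by metis
  then show ?case by (simp add: left_act_column_empty)
next
  case (Cons e p)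
  from Cons.prems obtain c where c: "e = (\<gamma>, c, right_act_letter \<gamma> c)" "\<gamma> \<subseteq> A" "frank \<gamma> c"
    "(right_act_letter \<gamma> c, p) \<in> paths (quiver A)" by (rule paths_quiver_Cons)
  have fin: "finite \<gamma>" using assms(1) c(2) finite_subset by blast
  have "left_act (column_word \<gamma> @ label (e # p)) {}
      = left_act_letter (bumped \<gamma> c) (left_act (column_word (right_act_letter \<gamma> c) @ label p) {})"
    using c(1) by (simp add: left_act_column_frank[OF fin c(3)])
  also have "\<dots> = \<gamma>"
    using Cons.IH[OF c(4)] left_act_letter_bumped[OF fin c(3)] by simp
  finally show ?case .
qed

text \<open>
  \<open>\<gamma>c\<gamma>' \<equiv> b\<gamma>'\<gamma>' \<equiv> b\<gamma>' \<equiv> \<gamma>c\<close>, since a column is idempotent.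
\<close>
lemma \<mu>_column_frank:
  assumes "finite A" "\<gamma> \<subseteq> A" "frank \<gamma> c"
  shows "\<mu> A (column_word \<gamma> @ c # column_word (right_act_letter \<gamma> c)) = \<mu> A (column_word \<gamma> @ [c])"
proof
  fix \<delta>
  have "finite \<gamma>" using assms finite_subset by blast
  moreover have "finite (right_act_letter \<gamma> c)"
    using frank_bumped(4)[OF \<open>finite \<gamma>\<close> assms(3)] \<open>finite \<gamma>\<close> by simp
  moreover have "finite \<delta>" if "\<delta> \<in> columns A"
    using that assms(1) finite_subset by (auto simp: columns_def)
  ultimately show "\<mu> A (column_word \<gamma> @ c # column_word (right_act_letter \<gamma> c)) \<delta> =
      \<mu> A (column_word \<gamma> @ [c]) \<delta>"
    using assms(3) by (simp add: \<mu>_def left_act_column_frank left_act_column_idem)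
qed

section \<open>The homomorphism on paths\<close>

context
  fixes A :: "'a::linorder set"
  assumes fin: "finite A"
begin

interpretation ZS: ring "ZStyl A" by (rule ring_ZStyl)

text \<open>
  Each letter outside \<open>\<gamma>\<close> strictly raises the rank of \<open>w \<cdot> \<emptyset> = \<gamma>\<close>, and later letters do not lower it
  again. So all terms of the expansion but the first are killed by \<open>X\<close>.
\<close>
lemma mult_complement_prod:
  assumes zero: "\<And>w. w \<in> lists A \<Longrightarrow> column_rank A \<gamma> < column_rank A (left_act w {}) \<Longrightarrow>
      X \<otimes>\<^bsub>ZStyl A\<^esub> word_elt A w = 0"
    and "set as \<subseteq> A - \<gamma>" "w \<in> lists A" "left_act w {} = \<gamma>"
  shows "X \<otimes>\<^bsub>ZStyl A\<^esub> (complement_prod A as \<otimes>\<^bsub>ZStyl A\<^esub> word_elt A w)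
    = X \<otimes>\<^bsub>ZStyl A\<^esub> word_elt A w"
proof -
  have higher: "X \<otimes>\<^bsub>ZStyl A\<^esub> (complement_prod A as \<otimes>\<^bsub>ZStyl A\<^esub> word_elt A w) = 0"
    if "set as \<subseteq> A" "w \<in> lists A" "column_rank A \<gamma> < column_rank A (left_act w {})" for as w
    using that
  proof (induction as arbitrary: w rule: rev_induct)
    case Nil
    then show ?case by (simp add: complement_prod_Nil_mult zero)
  next
    case (snoc a as)
    then have "column_rank A \<gamma> < column_rank A (left_act (a # w) {})"
      using column_rank_left_act_letter_le[of "left_act w {}" A a] by simp
    with snoc show ?case
      by (simp add: complement_prod_snoc_mult monoid_algebra_mult_diff)
  qed
  have "finite \<gamma>" using finite_left_act[of "{}" w] assms(4) by simp
  show ?thesis using assms(2)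
  proof (induction as rule: rev_induct)
    case Nil
    then show ?case using assms(3) by (simp add: complement_prod_Nil_mult)
  next
    case (snoc a as)
    then have "column_rank A \<gamma> < column_rank A (left_act (a # w) {})"
      using column_rank_left_act_letter_less[OF fin, of \<gamma> a] assms(4) \<open>finite \<gamma>\<close> by simp
    moreover have "set as \<subseteq> A" "a \<in> A" using snoc.prems by auto
    ultimately show ?case
      using snoc higher[of as "a # w"] assms(3)
      by (simp add: complement_prod_snoc_mult monoid_algebra_mult_diff)
  qed
qed

text \<open>
  If \<open>w \<cdot> \<emptyset>\<close> has larger rank than \<open>\<gamma>'\<close>, then so has \<open>\<gamma>'w \<cdot> \<emptyset>\<close>, hence \<open>\<gamma>cw \<cdot> \<emptyset> \<noteq> \<gamma>\<close> and
  \<open>e\<^sub>\<gamma> c w = 0\<close>. So only the leading term of \<open>e\<^bsub>\<gamma>'\<^esub>\<close> survives in \<open>e\<^sub>\<gamma> c e\<^bsub>\<gamma>'\<^esub>\<close>, and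
  \<open>\<gamma>c\<gamma>' \<equiv> \<gamma>c\<close> absorbs it.
\<close>
lemma e_col_frank:
  assumes "\<gamma> \<subseteq> A" "c \<in> A" "frank \<gamma> c"
  shows "e_col A \<gamma> \<otimes>\<^bsub>ZStyl A\<^esub> letter A c \<otimes>\<^bsub>ZStyl A\<^esub> e_col A (right_act_letter \<gamma> c)
    = e_col A \<gamma> \<otimes>\<^bsub>ZStyl A\<^esub> letter A c"
proof -
  define \<gamma>' X where "\<gamma>' = right_act_letter \<gamma> c" and "X = e_col A \<gamma> \<otimes>\<^bsub>ZStyl A\<^esub> letter A c"
  have finite: "finite \<gamma>" "\<gamma>' \<subseteq> A" "finite \<gamma>'"
    using assms fin finite_subset by (auto simp: \<gamma>'_def right_act_letter_def)
  have X: "X \<otimes>\<^bsub>ZStyl A\<^esub> word_elt A w = e_col A \<gamma> \<otimes>\<^bsub>ZStyl A\<^esub> word_elt A (c # w)"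
    if "w \<in> lists A" for w
    using that assms fin by (simp add: X_def letter_def ZS.m_assoc e_col_closed)
  have "X \<otimes>\<^bsub>ZStyl A\<^esub> word_elt A w = 0"
    if w: "w \<in> lists A" and less: "column_rank A \<gamma>' < column_rank A (left_act w {})" for w
  proof -
    have "left_act (column_word \<gamma> @ c # w) {} \<noteq> \<gamma>"
    proof
      assume "left_act (column_word \<gamma> @ c # w) {} = \<gamma>"
      then have "left_act (column_word \<gamma>') (left_act w {}) = \<gamma>'"
        unfolding \<gamma>'_def using finite(1) assms(3) by (intro frank_left_act_eqD) simp_all
      with column_rank_left_act_le[of "left_act w {}" A "column_word \<gamma>'"] less show False by simp
    qed
    with w assms fin show ?thesis by (simp add: X e_col_mult_word_eq_0)
  qed
  then have "X \<otimes>\<^bsub>ZStyl A\<^esub> e_col A \<gamma>' = X \<otimes>\<^bsub>ZStyl A\<^esub> word_elt A (column_word \<gamma>')"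
    unfolding e_col_eq[OF fin finite(2)]
    using fin finite by (intro mult_complement_prod) (auto simp: left_act_column_empty column_word_lists)
  also have "\<dots> = X"
    using assms fin finite column_word_lists[OF fin finite(2)] \<mu>_column_frank[OF fin assms(1,3)]
    by (simp add: X e_col_mult_word) (simp add: X_def letter_def e_col_mult_word \<gamma>'_def)
  finally show ?thesis by (simp add: X_def \<gamma>'_def)
qed

lemma \<phi>_path_eq_e_col_mult:
  assumes "(\<gamma>, p) \<in> paths (quiver A)"
  shows "\<phi>_path A (\<gamma>, p) = e_col A \<gamma> \<otimes>\<^bsub>ZStyl A\<^esub> word_elt A (label p)"
proof -
  let ?step = "\<lambda>x (\<gamma>, c, \<gamma>'). (x \<otimes>\<^bsub>ZStyl A\<^esub> letter A c) \<otimes>\<^bsub>ZStyl A\<^esub> e_col A \<gamma>'"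
  (* The left factor Y makes the induction go through: it collects the part of the path already
     read, and only the idempotent at the current vertex is needed to absorb the next one. *)
  have "foldl ?step (Y \<otimes>\<^bsub>ZStyl A\<^esub> e_col A \<gamma>) p
      = Y \<otimes>\<^bsub>ZStyl A\<^esub> e_col A \<gamma> \<otimes>\<^bsub>ZStyl A\<^esub> word_elt A (label p)"
    if "Y \<in> carrier (ZStyl A)" for Y
    using assms that
  proof (induction p arbitrary: \<gamma> Y)
    case Nil
    then show ?case
      using e_col_closed[OF fin paths_quiver_columns[OF Nil(1)]] by (simp flip: one_ZStyl)
  next
    case (Cons e p)
    from Cons.prems(1) obtain c where c: "e = (\<gamma>, c, right_act_letter \<gamma> c)" "\<gamma> \<subseteq> A" "c \<in> A"
      "frank \<gamma> c" "(right_act_letter \<gamma> c, p) \<in> paths (quiver A)" by (rule paths_quiver_Cons)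
    let ?e = "e_col A \<gamma>" and ?e' = "e_col A (right_act_letter \<gamma> c)" and ?c = "letter A c"
    have closed: "?e \<in> carrier (ZStyl A)" "?e' \<in> carrier (ZStyl A)" "?c \<in> carrier (ZStyl A)"
      using c fin paths_quiver_columns[OF c(5)] by (simp_all add: e_col_closed letter_def)
    note label = label_paths_quiver[OF c(5)]
    have absorb: "Y \<otimes>\<^bsub>ZStyl A\<^esub> ?e \<otimes>\<^bsub>ZStyl A\<^esub> ?c \<otimes>\<^bsub>ZStyl A\<^esub> ?e' = Y \<otimes>\<^bsub>ZStyl A\<^esub> ?e \<otimes>\<^bsub>ZStyl A\<^esub> ?c"
      using e_col_frank[OF c(2-4)] Cons.prems(2) closed by (simp add: ZS.m_assoc)
    have "foldl ?step (Y \<otimes>\<^bsub>ZStyl A\<^esub> ?e) (e # p)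
        = foldl ?step (Y \<otimes>\<^bsub>ZStyl A\<^esub> ?e \<otimes>\<^bsub>ZStyl A\<^esub> ?c \<otimes>\<^bsub>ZStyl A\<^esub> ?e') p"
      by (simp add: c(1))
    also have "\<dots> = Y \<otimes>\<^bsub>ZStyl A\<^esub> ?e \<otimes>\<^bsub>ZStyl A\<^esub> ?c \<otimes>\<^bsub>ZStyl A\<^esub> word_elt A (label p)"
      using Cons.IH[OF c(5), of "Y \<otimes>\<^bsub>ZStyl A\<^esub> ?e \<otimes>\<^bsub>ZStyl A\<^esub> ?c"] Cons.prems(2) closed
      unfolding absorb by simp
    also have "\<dots> = Y \<otimes>\<^bsub>ZStyl A\<^esub> ?e \<otimes>\<^bsub>ZStyl A\<^esub> word_elt A (label (e # p))"
      using c(1,3) closed Cons.prems(2) label by (simp add: ZS.m_assoc letter_def)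
    finally show ?case .
  qed
  from this[of "\<one>\<^bsub>ZStyl A\<^esub>"] show ?thesis
    using e_col_closed[OF fin paths_quiver_columns[OF assms]] by (simp add: \<phi>_path_def)
qed

end

section \<open>The kernel\<close>

definition path_elt :: "'a::linorder set \<Rightarrow> 'a set \<times> ('a set \<times> 'a \<times> 'a set) list \<Rightarrow> 'a set \<Rightarrow> 'a set"
  where "path_elt A = (\<lambda>(\<gamma>, p). \<mu> A (column_word \<gamma> @ label p))"

text \<open>
  The map whose composition with \<open>path_elt\<close> is \<open>\<phi>\<close>. The vertex \<open>\<gamma>\<close> is read off from \<open>m\<close> as \<open>m {}\<close>,
  so the factor in front depends on \<open>m\<close> alone.
\<close>
definition complement_lift :: "'a::linorder set \<Rightarrow> ('a set \<Rightarrow> 'a set) \<Rightarrow> ('a set \<Rightarrow> 'a set) \<Rightarrow>\<^sub>0 int"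
  where "complement_lift A m =
    complement_prod A (sorted_list_of_set (A - m {})) \<otimes>\<^bsub>ZStyl A\<^esub> frag_of m"

lemma path_elt_empty:
  assumes "finite A" "x \<in> paths (quiver A)"
  shows "path_elt A x {} = fst x"
  using assms left_act_column_path_label by (cases x) (simp add: path_elt_def)

lemma \<phi>_path_eq_complement_lift:
  assumes "finite A" "x \<in> paths (quiver A)"
  shows "\<phi>_path A x = complement_lift A (path_elt A x)"
proof (cases x)
  case (Pair \<gamma> p)
  with assms(2) have p: "(\<gamma>, p) \<in> paths (quiver A)" by simp
  from assms p show ?thesis
    using path_elt_empty[OF assms] Pair paths_quiver_columns[OF p] label_paths_quiver[OF p]
    by (simp add: \<phi>_path_eq_e_col_mult e_col_mult_word complement_lift_def)
      (simp add: path_elt_def)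
qed

lemma frag_extend_complement_lift_eq_0D:
  assumes "finite A" "f \<in> carrier (ZStyl A)" "frag_extend (complement_lift A) f = 0"
  shows "f = 0"
proof (rule frag_extend_unitriangular_eq_0D[where r = "\<lambda>m. column_rank A (m {})"])
  fix m assume "m \<in> Poly_Mapping.keys f"
  with assms(2) obtain w where "w \<in> lists A" "m = \<mu> A w"
    by (auto simp: monoid_algebra_simps carrier_Styl)
  with assms(1) show "Poly_Mapping.keys (complement_lift A m - frag_of m)
      \<subseteq> {m'. column_rank A (m {}) < column_rank A (m' {})}"
    using keys_complement_prod_mult_diff[of A "sorted_list_of_set (A - m {})" w]
    by (simp add: complement_lift_def)
qed (fact assms(3))

lemma path_elt_closed:
  assumes "finite A" "x \<in> paths (quiver A)"
  shows "path_elt A x \<in> carrier (Styl A)"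
proof (cases x)
  case (Pair \<gamma> p)
  with assms(2) have p: "(\<gamma>, p) \<in> paths (quiver A)" by simp
  have "column_word \<gamma> @ label p \<in> lists A"
    using column_word_lists[OF assms(1) paths_quiver_columns[OF p]] label_paths_quiver[OF p] by simp
  with Pair show ?thesis by (simp add: path_elt_def carrier_Styl)
qed

lemma \<phi>_eq_complement_lift:
  assumes "finite A" "Poly_Mapping.keys f \<subseteq> paths (quiver A)"
  shows "\<phi> A f = frag_extend (complement_lift A) (frag_extend (\<lambda>x. frag_of (path_elt A x)) f)"
  using assms(2)
  by (induction f rule: frag_induction)
    (simp_all add: \<phi>_def frag_extend_diff \<phi>_path_eq_complement_lift[OF assms(1)])

theorem proposition4p14:
  fixes A :: "'a::linorder set"
  assumes "finite A"
  shows "a_kernel (path_algebra (quiver A)) (ZStyl A) (\<phi> A) =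
    frag.span {frag_of (\<gamma>, p) - frag_of (\<gamma>, q) | \<gamma> p q.
      (\<gamma>, p) \<in> paths (quiver A) \<and> (\<gamma>, q) \<in> paths (quiver A) \<and>
      styl_equiv A (column_word \<gamma> @ label p) (column_word \<gamma> @ label q)}"
    (is "?K = frag.span ?D")
proof
  let ?P = "paths (quiver A)"
  have K: "?K = {f. Poly_Mapping.keys f \<subseteq> ?P \<and> \<phi> A f = 0}"
    by (simp add: a_kernel_def' path_algebra_def monoid_algebra_simps)
  show "frag.span ?D \<subseteq> ?K"
  proof (rule frag.span_minimal)
    show "frag.subspace ?K"
      unfolding K
    proof (intro frag.subspaceI)
      fix f g :: "'a set \<times> ('a set \<times> 'a \<times> 'a set) list \<Rightarrow>\<^sub>0 int" and k
      assume f: "f \<in> {f. Poly_Mapping.keys f \<subseteq> ?P \<and> \<phi> A f = 0}"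
      then show "frag_cmul k f \<in> {f. Poly_Mapping.keys f \<subseteq> ?P \<and> \<phi> A f = 0}"
        using keys_cmul[of k f] by (auto simp: \<phi>_def frag_extend_cmul)
      assume "g \<in> {f. Poly_Mapping.keys f \<subseteq> ?P \<and> \<phi> A f = 0}"
      with f show "f + g \<in> {f. Poly_Mapping.keys f \<subseteq> ?P \<and> \<phi> A f = 0}"
        using keys_add[of f g] by (auto simp: \<phi>_def frag_extend_add)
    qed (simp add: \<phi>_def)
    show "?D \<subseteq> ?K"
    proof
      fix f assume "f \<in> ?D"
      then obtain \<gamma> p q where f: "f = frag_of (\<gamma>, p) - frag_of (\<gamma>, q)"
        and paths: "(\<gamma>, p) \<in> ?P" "(\<gamma>, q) \<in> ?P" and eq: "path_elt A (\<gamma>, p) = path_elt A (\<gamma>, q)"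
        by (auto simp: styl_equiv_def path_elt_def)
      have "Poly_Mapping.keys f \<subseteq> ?P"
        unfolding f by (intro keys_diff_subset) (simp_all add: keys_frag_of paths)
      moreover have "\<phi> A f = 0"
        using paths eq
        by (simp add: f \<phi>_def frag_extend_diff \<phi>_path_eq_complement_lift[OF assms])
      ultimately show "f \<in> ?K" unfolding K by simp
    qed
  qed
  show "?K \<subseteq> frag.span ?D"
  proof
    fix f assume "f \<in> ?K"
    then have keys: "Poly_Mapping.keys f \<subseteq> ?P" and zero: "\<phi> A f = 0" unfolding K by simp_all
    let ?g = "frag_extend (\<lambda>x. frag_of (path_elt A x)) f"
    have "?g \<in> carrier (ZStyl A)"
      unfolding monoid_algebra_simps
    proof clarify
      fix m assume "m \<in> Poly_Mapping.keys ?g"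
      then obtain x where "x \<in> Poly_Mapping.keys f" "m = path_elt A x"
        using keys_frag_extend[of "\<lambda>x. frag_of (path_elt A x)" f] by (auto simp: keys_frag_of)
      with keys path_elt_closed[OF assms] show "m \<in> carrier (Styl A)" by blast
    qed
    then have "?g = 0"
      using zero unfolding \<phi>_eq_complement_lift[OF assms keys]
      by (rule frag_extend_complement_lift_eq_0D[OF assms])
    with keys have "f \<in> frag.span {frag_of x - frag_of y | x y.
        x \<in> ?P \<and> y \<in> ?P \<and> path_elt A x = path_elt A y}"
      by (rule frag_extend_eq_0_imp_span)
    moreover have "{frag_of x - frag_of y | x y. x \<in> ?P \<and> y \<in> ?P \<and> path_elt A x = path_elt A y} \<subseteq> ?D"
    proof clarify
      fix \<gamma> p \<gamma>' q
      assume paths: "(\<gamma>, p) \<in> ?P" "(\<gamma>', q) \<in> ?P" and eq: "path_elt A (\<gamma>, p) = path_elt A (\<gamma>', q)"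
      have "\<gamma> = \<gamma>'"
        using path_elt_empty[OF assms paths(1)] path_elt_empty[OF assms paths(2)] eq by simp
      with paths eq show "\<exists>\<delta> p' q'. frag_of (\<gamma>, p) - frag_of (\<gamma>', q) = frag_of (\<delta>, p') - frag_of (\<delta>, q') \<and>
          (\<delta>, p') \<in> ?P \<and> (\<delta>, q') \<in> ?P \<and>
          styl_equiv A (column_word \<delta> @ label p') (column_word \<delta> @ label q')"
        by (auto simp: styl_equiv_def path_elt_def)
    qed
    ultimately show "f \<in> frag.span ?D" using frag.span_mono by blast
  qed
qed

end
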